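(* There exist a nonempty compact convex subset $K \subset \ell^2(\mathbb{Z}_+;\mathbb{R}^2)$ (compact with respect to the norm topology) and continuous maps $F, G : K \to K$ such that $F\circ G = G\circ F$, but $F(x) \neq G(x)$ for every $x \in K$. Consequently, the following assertion (Horn's conjecture) is false: "for every nonempty compact convex subset $K$ of a Banach space and all continuous maps $F,G:K\to K$ satisfying $F\circ G=G\circ F$, there exists $x\in K$ such that $F(x)=G(x)$."
   Context: $\mathbb{Z}_+$ denotes the set of nonnegative integers. All vector spaces are real. $\ell^2(\mathbb{Z}_+;\mathbb{R}^2)$ denotes the Hilbert direct sum of countably many copies of the Euclidean plane $\mathbb{R}^2$, i.e. the space of sequences $x=(x_n)_{n\in\mathbb{Z}_+}$ with $x_n\in\mathbb{R}^2$ and $\sum_{n=0}^\infty \|x_n\|^2<\infty$ (Euclidean norm), with coordinatewise operations and inner product $\langle x,y\rangle=\sum_{n\in\mathbb{Z}_+}\langle x_n,y_n\rangle$. Subsets carry the topology induced by the norm. *)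

theory Defs
  imports "HOL-Analysis.Analysis"
begin

section \<open>Square-summable sequences in an inner product space\<close>

definition square_summable :: "(nat \<Rightarrow> 'a::real_inner) \<Rightarrow> bool" where
  "square_summable x \<longleftrightarrow> summable (\<lambda>n. (norm (x n))\<^sup>2)"

lemma square_summable_0: "square_summable (\<lambda>_. 0)"
  by (simp add: square_summable_def)

lemma square_summable_scaleR:
  assumes "square_summable x"
  shows "square_summable (\<lambda>n. r *\<^sub>R x n)"
  using summable_mult[OF assms[unfolded square_summable_def], of "r\<^sup>2"]
  by (simp add: square_summable_def power_mult_distrib)

lemma square_summable_add:
  assumes "square_summable x" "square_summable y"
  shows "square_summable (\<lambda>n. x n + y n)"
  unfolding square_summable_def
proof (rule summable_comparison_test')
  show "summable (\<lambda>n. 2 * (norm (x n))\<^sup>2 + 2 * (norm (y n))\<^sup>2)"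
    using assms unfolding square_summable_def by (intro summable_add summable_mult)
  fix n :: nat
  have "(norm (x n + y n))\<^sup>2 \<le> (norm (x n) + norm (y n))\<^sup>2"
    by (intro power_mono norm_triangle_ineq norm_ge_zero)
  also have "\<dots> \<le> 2 * (norm (x n))\<^sup>2 + 2 * (norm (y n))\<^sup>2"
    using zero_le_power2[of "norm (x n) - norm (y n)"]
    by (simp add: power2_eq_square algebra_simps)
  finally show "norm ((norm (x n + y n))\<^sup>2) \<le> 2 * (norm (x n))\<^sup>2 + 2 * (norm (y n))\<^sup>2"
    by simp
qed

lemma square_summable_uminus: "square_summable x \<Longrightarrow> square_summable (\<lambda>n. - x n)"
  by (simp add: square_summable_def)

lemma square_summable_diff:
  "square_summable x \<Longrightarrow> square_summable y \<Longrightarrow> square_summable (\<lambda>n. x n - y n)"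
  using square_summable_add[OF _ square_summable_uminus, of x y] by simp

lemma summable_inner:
  assumes "square_summable x" "square_summable y"
  shows "summable (\<lambda>n. inner (x n) (y n))"
proof (rule summable_comparison_test')
  show "summable (\<lambda>n. (norm (x n))\<^sup>2 + (norm (y n))\<^sup>2)"
    using assms unfolding square_summable_def by (intro summable_add)
  fix n :: nat
  have "\<bar>inner (x n) (y n)\<bar> \<le> norm (x n) * norm (y n)"
    by (rule Cauchy_Schwarz_ineq2)
  also have "\<dots> \<le> (norm (x n))\<^sup>2 + (norm (y n))\<^sup>2"
    using sum_squares_bound[of "norm (x n)" "norm (y n)"]
      mult_nonneg_nonneg[OF norm_ge_zero[of "x n"] norm_ge_zero[of "y n"]]
    unfolding mult.assoc by linarith
  finally show "norm (inner (x n) (y n)) \<le> (norm (x n))\<^sup>2 + (norm (y n))\<^sup>2"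
    by simp
qed

typedef (overloaded) 'a ell2 = "{x :: nat \<Rightarrow> 'a::real_inner. square_summable x}"
  morphisms coord Abs_ell2
  using square_summable_0 by blast

setup_lifting type_definition_ell2

lemma square_summable_coord: "square_summable (coord x)"
  using coord[of x] by simp

lemma ell2_eqI: "(\<And>n. coord x n = coord y n) \<Longrightarrow> x = y"
  by (simp add: coord_inject[symmetric] fun_eq_iff)

instantiation ell2 :: (real_inner) real_vector
begin

lift_definition zero_ell2 :: "'a ell2" is "\<lambda>_. 0"
  by (rule square_summable_0)
lift_definition plus_ell2 :: "'a ell2 \<Rightarrow> 'a ell2 \<Rightarrow> 'a ell2" is "\<lambda>x y n. x n + y n"
  by (rule square_summable_add)
lift_definition uminus_ell2 :: "'a ell2 \<Rightarrow> 'a ell2" is "\<lambda>x n. - x n"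
  by (rule square_summable_uminus)
lift_definition minus_ell2 :: "'a ell2 \<Rightarrow> 'a ell2 \<Rightarrow> 'a ell2" is "\<lambda>x y n. x n - y n"
  by (rule square_summable_diff)
lift_definition scaleR_ell2 :: "real \<Rightarrow> 'a ell2 \<Rightarrow> 'a ell2" is "\<lambda>r x n. r *\<^sub>R x n"
  by (rule square_summable_scaleR)

instance
  by standard (transfer; simp add: algebra_simps)+

end

instantiation ell2 :: (real_inner) real_inner
begin

lift_definition inner_ell2 :: "'a ell2 \<Rightarrow> 'a ell2 \<Rightarrow> real" is
  "\<lambda>x y. \<Sum>n. inner (x n) (y n)" .

definition norm_ell2 :: "'a ell2 \<Rightarrow> real" where "norm_ell2 x = sqrt (inner x x)"
definition dist_ell2 :: "'a ell2 \<Rightarrow> 'a ell2 \<Rightarrow> real" where "dist_ell2 x y = norm (x - y)"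
definition sgn_ell2 :: "'a ell2 \<Rightarrow> 'a ell2" where "sgn_ell2 x = x /\<^sub>R norm x"
definition uniformity_ell2 :: "('a ell2 \<times> 'a ell2) filter" where
  "uniformity_ell2 = (INF e\<in>{0<..}. principal {(x, y). dist x y < e})"
definition open_ell2 :: "'a ell2 set \<Rightarrow> bool" where
  "open_ell2 U \<longleftrightarrow> (\<forall>x\<in>U. eventually (\<lambda>(x', y). x' = x \<longrightarrow> y \<in> U) uniformity)"

instance
proof
  fix x y z :: "'a ell2" and r :: real and U :: "'a ell2 set"
  show "dist x y = norm (x - y)" by (rule dist_ell2_def)
  show "sgn x = x /\<^sub>R norm x" by (rule sgn_ell2_def)
  show "uniformity = (INF e\<in>{0<..}. principal {(x :: 'a ell2, y). dist x y < e})"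
    by (rule uniformity_ell2_def)
  show "open U \<longleftrightarrow> (\<forall>x\<in>U. eventually (\<lambda>(x', y). x' = x \<longrightarrow> y \<in> U) uniformity)"
    by (rule open_ell2_def)
  show "inner x y = inner y x"
    by transfer (simp add: inner_commute)
  show "inner (x + y) z = inner x z + inner y z"
    by transfer (simp add: inner_add_left suminf_add[symmetric] summable_inner)
  show "inner (r *\<^sub>R x) y = r * inner x y"
    by transfer (simp add: suminf_mult summable_inner)
  show "0 \<le> inner x x"
    by transfer (auto intro!: suminf_nonneg summable_inner)
  show "inner x x = 0 \<longleftrightarrow> x = 0"
    by transfer (auto simp: suminf_eq_zero_iff summable_inner fun_eq_iff)
  show "norm x = sqrt (inner x x)" by (rule norm_ell2_def)
qed

end

lemma coord_0 [simp]: "coord 0 n = 0"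
  by (simp add: zero_ell2.rep_eq)
lemma coord_add [simp]: "coord (x + y) n = coord x n + coord y n"
  by (simp add: plus_ell2.rep_eq)
lemma coord_minus [simp]: "coord (- x) n = - coord x n"
  by (simp add: uminus_ell2.rep_eq)
lemma coord_diff [simp]: "coord (x - y) n = coord x n - coord y n"
  by (simp add: minus_ell2.rep_eq)
lemma coord_scaleR [simp]: "coord (r *\<^sub>R x) n = r *\<^sub>R coord x n"
  by (simp add: scaleR_ell2.rep_eq)

lemma inner_ell2_sums: "(\<lambda>n. inner (coord x n) (coord y n)) sums inner x y"
  by (simp add: inner_ell2.rep_eq summable_sums summable_inner square_summable_coord)

lemma norm_ell2_sums: "(\<lambda>n. (norm (coord x n))\<^sup>2) sums (norm x)\<^sup>2"
  using inner_ell2_sums[of x x] by (simp add: power2_norm_eq_inner)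

lemma sum_coord_le_norm: "(\<Sum>i<n. (norm (coord x i))\<^sup>2) \<le> (norm x)\<^sup>2"
  using norm_ell2_sums[of x] sum_le_suminf[of "\<lambda>i. (norm (coord x i))\<^sup>2" "{..<n}"]
  by (simp add: sums_iff)

lemma norm_coord_le: "norm (coord x n) \<le> norm x"
proof -
  have "(norm (coord x n))\<^sup>2 \<le> (\<Sum>i<Suc n. (norm (coord x i))\<^sup>2)"
    by (simp add: sum_nonneg)
  also have "\<dots> \<le> (norm x)\<^sup>2" by (rule sum_coord_le_norm)
  finally show ?thesis by (rule power2_le_imp_le) simp
qed

instance ell2 :: ("{real_inner, complete_space}") complete_space
proof
  fix X :: "nat \<Rightarrow> 'a ell2"
  assume X: "Cauchy X"
  have "Cauchy (\<lambda>k. coord (X k) n)" for n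
  proof (rule metric_CauchyI)
    fix e :: real assume "e > 0"
    with X obtain M where "\<forall>m\<ge>M. \<forall>k\<ge>M. dist (X m) (X k) < e"
      by (meson metric_CauchyD)
    then show "\<exists>M. \<forall>m\<ge>M. \<forall>k\<ge>M. dist (coord (X m) n) (coord (X k) n) < e"
      by (metis coord_diff dist_norm norm_coord_le order_le_less_trans)
  qed
  then have "\<exists>l. (\<lambda>k. coord (X k) n) \<longlonglongrightarrow> l" for n
    using Cauchy_convergent convergent_def by blast
  then obtain l where l: "\<And>n. (\<lambda>k. coord (X k) n) \<longlonglongrightarrow> l n"
    by metis
  have tail: "\<exists>M. \<forall>m\<ge>M. \<forall>N. (\<Sum>n<N. (norm (coord (X m) n - l n))\<^sup>2) \<le> e\<^sup>2" if "e > 0" for e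
  proof -
    from X that obtain M where M: "\<forall>m\<ge>M. \<forall>k\<ge>M. dist (X m) (X k) < e"
      by (meson metric_CauchyD)
    have "(\<Sum>n<N. (norm (coord (X m) n - l n))\<^sup>2) \<le> e\<^sup>2" if "m \<ge> M" for m N
    proof (rule tendsto_upperbound)
      show "(\<lambda>k. \<Sum>n<N. (norm (coord (X m) n - coord (X k) n))\<^sup>2)
              \<longlonglongrightarrow> (\<Sum>n<N. (norm (coord (X m) n - l n))\<^sup>2)"
        by (intro tendsto_intros l)
      have "(\<Sum>n<N. (norm (coord (X m) n - coord (X k) n))\<^sup>2) \<le> e\<^sup>2" if "k \<ge> M" for k
      proof -
        have "(\<Sum>n<N. (norm (coord (X m - X k) n))\<^sup>2) \<le> (norm (X m - X k))\<^sup>2"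
          by (rule sum_coord_le_norm)
        also have "\<dots> \<le> e\<^sup>2"
          using M \<open>m \<ge> M\<close> that by (intro power_mono) (auto simp: dist_norm less_imp_le)
        finally show ?thesis by simp
      qed
      then show "\<forall>\<^sub>F k in sequentially. (\<Sum>n<N. (norm (coord (X m) n - coord (X k) n))\<^sup>2) \<le> e\<^sup>2"
        by (auto simp: eventually_sequentially)
    qed simp
    then show ?thesis by blast
  qed
  have diff: "square_summable (\<lambda>n. coord (X m) n - l n)"
    if "\<forall>N. (\<Sum>n<N. (norm (coord (X m) n - l n))\<^sup>2) \<le> c" for m c
    unfolding square_summable_def by (rule summableI_nonneg_bounded[of _ c]) (use that in auto)
  obtain m where "\<forall>N. (\<Sum>n<N. (norm (coord (X m) n - l n))\<^sup>2) \<le> 1\<^sup>2"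
    using tail[of 1] by auto
  from square_summable_diff[OF square_summable_coord[of "X m"] diff[OF this]]
  have "square_summable l" by simp
  then obtain L where L: "coord L = l"
    using Abs_ell2_inverse[of l] by auto
  have "X \<longlonglongrightarrow> L"
  proof (rule metric_LIMSEQ_I)
    fix e :: real assume "e > 0"
    with tail[of "e / 2"] obtain M where
      M: "\<forall>m\<ge>M. \<forall>N. (\<Sum>n<N. (norm (coord (X m) n - l n))\<^sup>2) \<le> (e / 2)\<^sup>2"
      by auto
    have "dist (X m) L < e" if "m \<ge> M" for m
    proof -
      have "(norm (X m - L))\<^sup>2 \<le> (e / 2)\<^sup>2"
        using norm_ell2_sums[of "X m - L"] M that
        by (intro LIMSEQ_le_const2[of "\<lambda>N. \<Sum>n<N. (norm (coord (X m - L) n))\<^sup>2"])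
          (auto simp: sums_def L)
      then have "norm (X m - L) \<le> e / 2"
        by (rule power2_le_imp_le) (use \<open>e > 0\<close> in simp)
      with \<open>e > 0\<close> show ?thesis by (simp add: dist_norm)
    qed
    then show "\<exists>M. \<forall>m\<ge>M. dist (X m) L < e" by blast
  qed
  then show "convergent X" by (auto simp: convergent_def)
qed

instance ell2 :: ("{real_inner, complete_space}") banach ..


section \<open>Banach spaces as objects, and Horn's conjecture\<close>

text \<open>
  A formula can quantify over the Banach spaces given by a linear subspace \<open>V\<close> of
  a vector space type and a norm \<open>N\<close> on \<open>V\<close>, but not over the types of class
  \<^class>\<open>banach\<close>. The norm \<open>N\<close> need not be related to any norm that the type carries.
  Its values outside \<open>V\<close> are irrelevant and fixed to be \<open>0\<close>, which makes
  \<open>\<lambda>x y. N (x - y)\<close> symmetric and nonnegative everywhere, as required by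
  \<^locale>\<open>Metric_space\<close>.
\<close>

locale normed_space_on =
  fixes V :: "'a::real_vector set" and N :: "'a \<Rightarrow> real"
  assumes subspace_V: "subspace V"
    and N_outside: "x \<notin> V \<Longrightarrow> N x = 0"
    and N_nonneg: "x \<in> V \<Longrightarrow> 0 \<le> N x"
    and N_eq_0_iff: "x \<in> V \<Longrightarrow> N x = 0 \<longleftrightarrow> x = 0"
    and N_scaleR: "x \<in> V \<Longrightarrow> N (r *\<^sub>R x) = \<bar>r\<bar> * N x"
    and N_triangle: "x \<in> V \<Longrightarrow> y \<in> V \<Longrightarrow> N (x + y) \<le> N x + N y"
begin

lemma N_minus: "N (- x) = N x"
proof (cases "x \<in> V")
  case True
  then show ?thesis using N_scaleR[of x "-1"] by simp
next
  case False
  then have "- x \<notin> V" using subspace_neg[OF subspace_V, of "- x"] by auto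
  with False show ?thesis by (simp add: N_outside)
qed

sublocale Metric_space V "\<lambda>x y. N (x - y)"
proof
  show "0 \<le> N (x - y)" for x y
    by (cases "x - y \<in> V") (simp_all add: N_nonneg N_outside)
  show "N (x - y) = N (y - x)" for x y
    using N_minus[of "x - y"] by simp
  show "N (x - y) = 0 \<longleftrightarrow> x = y" if "x \<in> V" "y \<in> V" for x y
    using that by (simp add: N_eq_0_iff subspace_diff[OF subspace_V])
  show "N (x - z) \<le> N (x - y) + N (y - z)" if "x \<in> V" "y \<in> V" "z \<in> V" for x y z
    using that N_triangle[of "x - y" "y - z"] by (simp add: subspace_diff[OF subspace_V])
qed

end

locale banach_space_on = normed_space_on V N
  for V :: "'a::real_vector set" and N :: "'a \<Rightarrow> real" +
  assumes complete: mcomplete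

lemma banach_space_on_UNIV: "banach_space_on (UNIV :: 'a::banach set) norm"
proof -
  interpret normed_space_on "UNIV :: 'a set" norm
    by standard (auto simp: norm_triangle_ineq)
  have "Metric_space.mcomplete (UNIV :: 'a set) dist"
    by (simp add: complete_UNIV)
  then show ?thesis
    by unfold_locales (simp add: dist_norm[abs_def])
qed

definition norm_topology :: "'a::real_vector set \<Rightarrow> ('a \<Rightarrow> real) \<Rightarrow> 'a topology" where
  "norm_topology V N = Metric_space.mtopology V (\<lambda>x y. N (x - y))"

lemma norm_topology_UNIV: "norm_topology (UNIV :: 'a::real_normed_vector set) norm = euclidean"
  by (simp add: norm_topology_def dist_norm[abs_def, symmetric])

text \<open>
  The assertion for all Banach spaces whose vector space is a subspace of \<open>'a\<close>.
  Being a universal statement, it is refuted in general as soon as it is refuted for one \<open>'a\<close>.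
\<close>

definition Horn_conjecture :: "'a::real_vector itself \<Rightarrow> bool" where
  "Horn_conjecture _ \<longleftrightarrow>
    (\<forall>(V :: 'a set) N. banach_space_on V N \<longrightarrow>
      (\<forall>K F G.
        K \<noteq> {} \<and> compactin (norm_topology V N) K \<and> convex K \<and>
        continuous_map (subtopology (norm_topology V N) K) (subtopology (norm_topology V N) K) F \<and>
        continuous_map (subtopology (norm_topology V N) K) (subtopology (norm_topology V N) K) G \<and>
        (\<forall>x\<in>K. F (G x) = G (F x)) \<longrightarrow>
        (\<exists>x\<in>K. F x = G x)))"

end

theory Submission
  imports Defs
begin

text \<open>
  Suppose that \<open>D\<^sub>0, D\<^sub>1, \<dots>\<close> are compact absolute retracts and \<open>f\<^sub>n, g\<^sub>n : D\<^sub>n\<^sub>+\<^sub>1 \<rightarrow> D\<^sub>n\<close> are continuous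
  maps with \<open>f\<^sub>n \<circ> g\<^sub>n\<^sub>+\<^sub>1 = g\<^sub>n \<circ> f\<^sub>n\<^sub>+\<^sub>1\<close>. Then \<open>F(x)\<^sub>n = f\<^sub>n(x\<^sub>n\<^sub>+\<^sub>1)\<close> and \<open>G(x)\<^sub>n = g\<^sub>n(x\<^sub>n\<^sub>+\<^sub>1)\<close> are
  commuting self-maps of \<open>\<Prod>\<^sub>n D\<^sub>n\<close>, and a coincidence of \<open>F\<close> and \<open>G\<close> would give a coincidence of
  \<open>f\<^sub>0\<close> and \<open>g\<^sub>0\<close>. Precomposing with retractions of a convex body onto the \<open>D\<^sub>n\<close> turns them into
  self-maps of a product of convex bodies, which is a compact convex subset of \<open>\<ell>\<^sup>2\<close> once the
  coordinates are scaled by \<open>2\<^sup>-\<^sup>n\<close>. So it suffices to find such a ladder of maps in which \<open>f\<^sub>0\<close> and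
  \<open>g\<^sub>0\<close> never agree. The sequence \<open>(f\<^sub>n)\<close> then induces a fixed-point-free map of the inverse limit of
  \<open>(D\<^sub>n, g\<^sub>n)\<close>, so one looks for finite stages of a contractible continuum without the fixed point
  property.

  The continuum used here is the cone over a ray that winds onto a circle. Let \<open>\<Gamma>\<^sub>n\<close> be the ray
  \<open>[0, \<infinity>)\<close> with its points identified modulo \<open>2\<pi>\<close> from \<open>L\<^sub>n = (n + 1)\<pi>\<close> on, an arc with a loop at its
  end, and let \<open>D\<^sub>n\<close> be the cone over \<open>\<Gamma>\<^sub>n\<close>, realised in \<open>\<complex> \<times> \<real>\<close>. It is an absolute retract, being
  a disc (the cone over the loop) and a triangular sheet (the cone over the arc) glued along a
  radius (\<open>AR_wound_cone\<close>). All \<open>D\<^sub>n\<close> are quotients of the same half-strip of points \<open>(s, \<rho>)\<close>, where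
  \<open>\<rho> = 0\<close> is the apex; \<open>g\<^sub>n\<close> is induced by the identity of the half-strip and \<open>f\<^sub>n\<close> by a
  map \<open>move\<close> that does not depend on \<open>n\<close>, so the commutation is automatic. Outside the
  core \<open>\<rho> \<le> 1/2\<close>, which goes to the edge \<open>s = 0\<close>, \<open>move\<close> changes \<open>s\<close> by at most \<open>\<pi> = L\<^sub>n\<^sub>+\<^sub>1 - L\<^sub>n\<close>;
  hence it respects the identifications at the cost of one level (\<open>cone_pt_move_fibre\<close>).

  On the disc alone a fixed point would be forced by Brouwer's theorem. It is avoided because \<open>move\<close>
  sends the core of the disc off the disc, up the edge \<open>s = 0\<close> of the sheet, and changes \<open>s\<close> elsewhere
  by an amount that is a multiple of \<open>2\<pi>\<close> only where \<open>\<rho>\<close> changes (\<open>move_no_fixed_point\<close>).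
\<close>

section \<open>Functions on the image of a compact set\<close>

text \<open>
  A continuous map from a compact set is closed, hence a quotient map onto its image. The set \<open>S\<close> may
  be larger than the compact set \<open>C\<close> as long as it has the same image; this allows the values of the
  induced function to be read off from any preimage in \<open>S\<close>.
\<close>

lemma continuous_on_descend:
  fixes p :: "'a::metric_space \<Rightarrow> 'b::metric_space" and h :: "'a \<Rightarrow> 'c::metric_space"
  assumes C: "compact C" "C \<subseteq> S" "p ` C = p ` S"
    and p: "continuous_on C p" and h: "continuous_on C h"
    and fibre: "\<And>x y. x \<in> S \<Longrightarrow> y \<in> S \<Longrightarrow> p x = p y \<Longrightarrow> h x = h y"
  obtains f where "continuous_on (p ` S) f" "\<And>x. x \<in> S \<Longrightarrow> f (p x) = h x"
proof
  define f where "f y = h (inv_into S p y)" for y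
  show f: "f (p x) = h x" if "x \<in> S" for x
    unfolding f_def using that by (intro fibre) (auto intro: inv_into_into f_inv_into_f)
  have "continuous_on (p ` C) f"
    unfolding continuous_on_closed_invariant
  proof (intro allI impI)
    fix B :: "'c set" assume "closed B"
    then obtain A where A: "closed A" "A \<inter> C = h -` B \<inter> C"
      using h unfolding continuous_on_closed_invariant by metis
    have "compact (p ` (C \<inter> A))"
      using C(1) A(1) by (intro compact_continuous_image continuous_on_subset[OF p]) auto
    moreover have "p ` (C \<inter> A) \<inter> p ` C = f -` B \<inter> p ` C"
    proof -
      have "p x \<in> p ` (C \<inter> A) \<longleftrightarrow> f (p x) \<in> B" if "x \<in> C" for x
      proof
        assume "p x \<in> p ` (C \<inter> A)"
        then obtain y where y: "y \<in> C" "y \<in> A" "p x = p y" by auto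
        with A(2) C(2) show "f (p x) \<in> B" by (auto simp: f subset_iff)
      next
        assume "f (p x) \<in> B"
        with A(2) C(2) that show "p x \<in> p ` (C \<inter> A)" by (auto simp: f subset_iff)
      qed
      then show ?thesis by auto
    qed
    ultimately show "\<exists>A. closed A \<and> A \<inter> p ` C = f -` B \<inter> p ` C"
      by (metis compact_imp_closed)
  qed
  with C show "continuous_on (p ` S) f" by simp
qed

section \<open>Cones over an arc with a loop\<close>

definition halfstrip :: "(real \<times> real) set" where
  "halfstrip = {0..} \<times> {0..1}"

text \<open>
  The point of \<open>D\<^sub>n\<close> with coordinates \<open>(s, \<rho>)\<close>: the base \<open>\<Gamma>\<^sub>n\<close> of the cone is a helix over the unit
  circle that descends to height \<open>0\<close> at \<open>s = (n + 1)\<pi>\<close> and runs around the circle from then on.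
\<close>

definition cone_pt :: "nat \<Rightarrow> real \<times> real \<Rightarrow> complex \<times> real" where
  "cone_pt n = (\<lambda>(s, \<rho>). (of_real \<rho> * cis s, \<rho> * max 0 (1 - s / (real (Suc n) * pi))))"

lemma continuous_on_cone_pt [continuous_intros]:
  assumes "continuous_on S f" "continuous_on S g"
  shows "continuous_on S (\<lambda>x. cone_pt n (f x, g x))"
  unfolding cone_pt_def using assms
  by (auto intro!: continuous_intros simp: cis_conv_exp simp del: of_nat_Suc)

lemma cone_pt_apex [simp]: "cone_pt n (s, 0) = 0"
  by (simp add: cone_pt_def zero_prod_def)

lemma cone_pt_wrapped_eq:
  assumes "s \<ge> real (Suc n) * pi" "t \<ge> real (Suc n) * pi" "cis s = cis t"
  shows "cone_pt n (s, \<rho>) = cone_pt n (t, \<rho>)"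
proof -
  have "real (Suc n) * pi > 0" by simp
  then have "s / (real (Suc n) * pi) \<ge> 1" "t / (real (Suc n) * pi) \<ge> 1"
    using assms(1,2) by (simp_all add: le_divide_eq del: of_nat_Suc)
  then show ?thesis using assms(3) by (simp add: cone_pt_def max_def)
qed

text \<open>
  The only identifications are those at the apex and those modulo \<open>2\<pi>\<close> on the cone over the loop.
\<close>

lemma cone_pt_eqD:
  assumes eq: "cone_pt n (s, \<rho>) = cone_pt n (t, \<tau>)" and "\<rho> \<ge> 0" "\<tau> \<ge> 0"
  shows "\<rho> = \<tau>"
    and "\<rho> = 0 \<or> s = t \<or> (s \<ge> real (Suc n) * pi \<and> t \<ge> real (Suc n) * pi \<and> cis s = cis t)"
proof -
  let ?L = "real (Suc n) * pi"
  have L: "?L > 0" by simp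
  have 1: "of_real \<rho> * cis s = of_real \<tau> * cis t"
    and 2: "\<rho> * max 0 (1 - s / ?L) = \<tau> * max 0 (1 - t / ?L)"
    using eq by (simp_all add: cone_pt_def)
  from arg_cong[OF 1, of norm] show "\<rho> = \<tau>" using assms by (simp add: norm_mult)
  show "\<rho> = 0 \<or> s = t \<or> (s \<ge> ?L \<and> t \<ge> ?L \<and> cis s = cis t)"
  proof (cases "\<rho> = 0")
    case False
    with 1 2 \<open>\<rho> = \<tau>\<close> have "cis s = cis t" and m: "max 0 (1 - s / ?L) = max 0 (1 - t / ?L)"
      by auto
    moreover have "s = t \<or> (s / ?L \<ge> 1 \<and> t / ?L \<ge> 1)"
    proof (cases "s / ?L \<ge> 1 \<and> t / ?L \<ge> 1")
      case False
      with m have "s / ?L = t / ?L" by (auto simp: max_def split: if_splits)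
      with L show ?thesis by (simp del: of_nat_Suc)
    qed blast
    ultimately show ?thesis using L by (simp add: le_divide_eq del: of_nat_Suc)
  qed blast
qed

definition wound_cone :: "nat \<Rightarrow> (complex \<times> real) set" where
  "wound_cone n = cone_pt n ` halfstrip"

lemma real_mod_2pi_above:
  fixes s a :: real
  assumes "s \<ge> a"
  obtains t where "a \<le> t" "t \<le> a + 2 * pi" "cis t = cis s"
proof -
  define k where "k = \<lfloor>(s - a) / (2 * pi)\<rfloor>"
  have "of_int k \<le> (s - a) / (2 * pi)" "(s - a) / (2 * pi) < of_int k + 1"
    unfolding k_def by linarith+
  then have k: "of_int k * (2 * pi) \<le> s - a" "s - a \<le> (of_int k + 1) * (2 * pi)"
    by (simp_all add: le_divide_eq divide_less_eq)
  have "cis (s - of_int k * (2 * pi)) = cis s / cis (2 * pi * of_int k)"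
    by (simp add: cis_divide mult.commute)
  also have "\<dots> = cis s" by (simp add: cis_multiple_2pi)
  finally show thesis
    using k by (intro that[of "s - of_int k * (2 * pi)"]) (auto simp: algebra_simps)
qed

text \<open>A compact part of the half-strip that covers the arc and one turn of the loop.\<close>

definition rectangle :: "nat \<Rightarrow> (real \<times> real) set" where
  "rectangle n = {0..real (Suc n) * pi + 2 * pi} \<times> {0..1}"

lemma compact_rectangle: "compact (rectangle n)"
  unfolding rectangle_def by (intro compact_Times compact_Icc)

lemma rectangle_subset: "rectangle n \<subseteq> halfstrip"
  by (auto simp: rectangle_def halfstrip_def)

lemma cone_pt_rectangle: "cone_pt n ` rectangle n = cone_pt n ` halfstrip"
proof (rule equalityI)
  show "cone_pt n ` halfstrip \<subseteq> cone_pt n ` rectangle n"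
  proof (rule image_subsetI)
    fix x assume "x \<in> halfstrip"
    then obtain s \<rho> where x: "x = (s, \<rho>)" and H: "(s, \<rho>) \<in> halfstrip" by (cases x) simp
    let ?L = "real (Suc n) * pi"
    show "cone_pt n x \<in> cone_pt n ` rectangle n"
    proof (cases "s \<ge> ?L")
      case True
      then obtain t where t: "?L \<le> t" "t \<le> ?L + 2 * pi" "cis t = cis s"
        by (rule real_mod_2pi_above)
      then have "cone_pt n (s, \<rho>) = cone_pt n (t, \<rho>)"
        using True by (intro cone_pt_wrapped_eq) auto
      moreover have "t \<ge> 0" using t(1) by (rule order_trans[rotated]) simp
      ultimately show ?thesis
        using H t by (auto simp: x rectangle_def halfstrip_def simp del: of_nat_Suc)
    next
      case False
      then have "s \<le> ?L + 2 * pi" using pi_gt_zero by linarith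
      then show ?thesis
        using H by (intro imageI) (auto simp: x rectangle_def halfstrip_def simp del: of_nat_Suc)
    qed
  qed
qed (intro image_mono rectangle_subset)

lemma continuous_on_cone_pt': "continuous_on S (cone_pt n)"
  using continuous_on_cone_pt[of S fst snd n] by (simp add: continuous_intros)

lemma compact_wound_cone: "compact (wound_cone n)"
  unfolding wound_cone_def cone_pt_rectangle[symmetric]
  by (intro compact_continuous_image compact_rectangle continuous_on_cone_pt')

lemma wound_cone_subset: "wound_cone n \<subseteq> cball 0 1 \<times> {-1..1}"
proof (clarsimp simp: wound_cone_def halfstrip_def cone_pt_def norm_mult)
  fix s \<rho> :: real assume s: "0 \<le> s" "0 \<le> \<rho>" "\<rho> \<le> 1"
  let ?m = "max 0 (1 - s / ((1 + real n) * pi))"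
  have "?m \<ge> 0" "?m \<le> 1" using s by simp_all
  with s have "0 \<le> \<rho> * ?m" "\<rho> * ?m \<le> 1" by (simp_all add: mult_le_one)
  then show "- 1 \<le> \<rho> * ?m \<and> \<rho> * ?m \<le> 1" by linarith
qed

section \<open>The cones are absolute retracts\<close>

text \<open>
  On the sheet, \<open>s\<close> is determined by the last coordinate and the distance \<open>\<rho>\<close> from the axis, so forgetting the
  angle maps the sheet homeomorphically onto a triangle.
\<close>

lemma AR_sheet: "AR (cone_pt n ` ({0..real (Suc n) * pi} \<times> {0..1}))" (is "AR (cone_pt n ` ?R)")
proof -
  let ?L = "real (Suc n) * pi"
  have L: "?L > 0" by simp
  let ?T = "{(\<rho>, t). 0 \<le> t \<and> t \<le> \<rho> \<and> \<rho> \<le> (1::real)}"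
  define q :: "complex \<times> real \<Rightarrow> real \<times> real" where "q = (\<lambda>(w, t). (norm w, t))"
  have q: "q (cone_pt n (s, \<rho>)) = (\<rho>, \<rho> * (1 - s / ?L))" if "(s, \<rho>) \<in> ?R" for s \<rho>
    using that L by (auto simp: q_def cone_pt_def norm_mult max_def divide_le_eq simp del: of_nat_Suc)
  have img: "q ` cone_pt n ` ?R = ?T"
  proof (intro equalityI subsetI)
    fix y assume "y \<in> q ` cone_pt n ` ?R"
    then obtain s \<rho> where R: "(s, \<rho>) \<in> ?R" and y: "y = (\<rho>, \<rho> * (1 - s / ?L))"
      using q by auto
    have "0 \<le> 1 - s / ?L" "1 - s / ?L \<le> 1"
      using R L by (simp_all add: divide_le_eq del: of_nat_Suc)
    then show "y \<in> ?T" using R y by (auto simp: mult_left_le simp del: of_nat_Suc)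
  next
    fix y assume "y \<in> ?T"
    then obtain \<rho> t where y: "y = (\<rho>, t)" "0 \<le> t" "t \<le> \<rho>" "\<rho> \<le> 1" by auto
    define s where "s = ?L * (1 - t / \<rho>)"
    have "0 \<le> t / \<rho>" "t / \<rho> \<le> 1" using y by (auto simp: divide_le_eq_1)
    then have "0 \<le> s" "s \<le> ?L" unfolding s_def using L
      by (auto simp: mult_left_le simp del: of_nat_Suc intro!: mult_nonneg_nonneg)
    then have R: "(s, \<rho>) \<in> ?R" using y by simp
    have "1 - s / ?L = t / \<rho>" unfolding s_def using L by (simp del: of_nat_Suc)
    then have "q (cone_pt n (s, \<rho>)) = y" using q[OF R] y by simp
    then show "y \<in> q ` cone_pt n ` ?R" using R by (metis image_eqI)
  qed
  have inj: "inj_on q (cone_pt n ` ?R)"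
  proof (rule inj_onI)
    fix x y assume "x \<in> cone_pt n ` ?R" "y \<in> cone_pt n ` ?R" and xy: "q x = q y"
    then obtain s \<rho> s' \<rho>' where x: "x = cone_pt n (s, \<rho>)" "(s, \<rho>) \<in> ?R"
      and y: "y = cone_pt n (s', \<rho>')" "(s', \<rho>') \<in> ?R"
      by blast
    have \<rho>: "\<rho> = \<rho>'" and eq: "\<rho> * (1 - s / ?L) = \<rho> * (1 - s' / ?L)"
      using xy q[OF x(2)] q[OF y(2)] x y by auto
    show "x = y"
    proof (cases "\<rho> = 0")
      case True
      then show ?thesis using \<rho> x y by simp
    next
      case False
      with eq have "s / ?L = s' / ?L" by simp
      then have "s = s'" using L by (simp del: of_nat_Suc)
      with \<rho> x y show ?thesis by simp
    qed
  qed
  have "compact (cone_pt n ` ?R)"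
    by (intro compact_continuous_image compact_Times compact_Icc continuous_on_cone_pt')
  moreover have "continuous_on (cone_pt n ` ?R) q"
    unfolding q_def case_prod_unfold by (intro continuous_intros)
  ultimately have hom: "cone_pt n ` ?R homeomorphic ?T"
    using homeomorphic_compact[OF _ _ img inj] by blast
  have "?T = {x. 0 \<le> (0, 1) \<bullet> x} \<inter> {x. 0 \<le> (1, -1) \<bullet> x} \<inter> {x. (1, 0) \<bullet> x \<le> 1}"
    by auto
  then have "convex ?T"
    by (simp only:) (intro convex_Int convex_halfspace_le convex_halfspace_ge)
  moreover have "(0, 0) \<in> ?T" by simp
  ultimately have "AR ?T" by (intro convex_imp_AR) blast+
  then show ?thesis using homeomorphic_AR_iff_AR[OF hom] by blast
qed

lemma wound_cone_decomp:
  "wound_cone n = (cball 0 1 \<times> {0}) \<union> cone_pt n ` ({0..real (Suc n) * pi} \<times> {0..1})"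
  (is "_ = ?D \<union> cone_pt n ` ?R")
proof (intro equalityI subsetI)
  let ?L = "real (Suc n) * pi"
  have L: "?L > 0" by simp
  fix x assume "x \<in> wound_cone n"
  then obtain s \<rho> where x: "x = cone_pt n (s, \<rho>)" "s \<ge> 0" "0 \<le> \<rho>" "\<rho> \<le> 1"
    by (auto simp: wound_cone_def halfstrip_def)
  show "x \<in> ?D \<union> cone_pt n ` ?R"
  proof (cases "s \<le> ?L")
    case True
    then show ?thesis using x by auto
  next
    case False
    then have "s / ?L \<ge> 1" using L by (simp add: le_divide_eq del: of_nat_Suc)
    then have "snd x = 0" "norm (fst x) \<le> 1" using x by (auto simp: cone_pt_def norm_mult)
    then show ?thesis by (cases x) auto
  qed
next
  let ?L = "real (Suc n) * pi"
  have L: "?L > 0" by simp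
  fix x assume "x \<in> ?D \<union> cone_pt n ` ?R"
  then show "x \<in> wound_cone n"
  proof
    assume "x \<in> ?D"
    then obtain w where w: "x = (w, 0)" "norm w \<le> 1" by auto
    \<comment> \<open>enough full turns to put the argument of \<open>w\<close>, which is above \<open>-\<pi>\<close>, on the loop\<close>
    define s where "s = Arg w + 2 * pi * real (Suc n)"
    have Arg: "Arg w > - pi" using Arg_bounded[of w] by simp
    have pos: "pi * real n \<ge> 0" by simp
    have "s - ?L = Arg w + pi + pi * real n" unfolding s_def by (simp add: algebra_simps)
    with Arg pos have s: "s \<ge> ?L" by linarith
    have "cis s = cis (Arg w) * cis (2 * pi * real (Suc n))"
      unfolding s_def by (rule cis_mult[symmetric])
    also have "\<dots> = cis (Arg w)" using cis_multiple_2pi[of "real (Suc n)"] by simp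
    finally have "of_real (norm w) * cis s = w"
      using rcis_cmod_Arg[of w] by (simp add: rcis_def)
    moreover have "s / ?L \<ge> 1" using s L by (simp add: le_divide_eq del: of_nat_Suc)
    ultimately have "x = cone_pt n (s, norm w)" using w by (simp add: cone_pt_def)
    moreover have "s \<ge> 0" using s L by linarith
    then have "(s, norm w) \<in> halfstrip" using w by (simp add: halfstrip_def)
    ultimately show ?thesis by (auto simp: wound_cone_def)
  next
    assume "x \<in> cone_pt n ` ?R"
    then show ?thesis by (auto simp: wound_cone_def halfstrip_def)
  qed
qed

lemma AR_wound_cone: "AR (wound_cone n)"
  unfolding wound_cone_decomp
proof (rule AR_closed_Un)
  let ?L = "real (Suc n) * pi"
  let ?D = "cball (0::complex) 1 \<times> {0::real}"
  let ?R = "{0..?L} \<times> {0..(1::real)}"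
  have L: "?L > 0" by simp
  show "closed ?D" by (intro closed_Times) auto
  show "closed (cone_pt n ` ?R)"
    by (intro compact_imp_closed compact_continuous_image compact_Times compact_Icc continuous_on_cone_pt')
  show "AR ?D" by (intro convex_imp_AR convex_Times) auto
  show "AR (cone_pt n ` ?R)" by (rule AR_sheet)
  \<comment> \<open>disc and sheet meet in the radius over the point at which the arc joins the loop\<close>
  have "?D \<inter> cone_pt n ` ?R = closed_segment 0 (cis ?L, 0 :: real)"
  proof (intro equalityI subsetI)
    fix x assume "x \<in> ?D \<inter> cone_pt n ` ?R"
    then have "x \<in> ?D" "x \<in> cone_pt n ` ?R" by blast+
    from \<open>x \<in> ?D\<close> have "snd x = 0" by (simp add: mem_Times_iff)
    from \<open>x \<in> cone_pt n ` ?R\<close> obtain y where "x = cone_pt n y" "y \<in> ?R" by blast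
    with \<open>snd x = 0\<close> obtain s \<rho> where x: "x = cone_pt n (s, \<rho>)" "(s, \<rho>) \<in> ?R" "snd x = 0"
      by (cases y) simp
    then have "s / ?L \<le> 1" using L by (simp add: divide_le_eq del: of_nat_Suc)
    with x have "\<rho> * (1 - s / ?L) = 0" by (simp add: cone_pt_def max_def split: if_splits)
    then have "\<rho> = 0 \<or> s / ?L = 1" by auto
    then have "\<rho> = 0 \<or> s = ?L" using L by (auto simp: divide_eq_eq simp del: of_nat_Suc)
    then have "x = \<rho> *\<^sub>R (cis ?L, 0 :: real)"
      using x L by (auto simp: cone_pt_def scaleR_conv_of_real zero_prod_def simp del: of_nat_Suc)
    then show "x \<in> closed_segment 0 (cis ?L, 0 :: real)"
      using x(2) by (auto simp: closed_segment_def)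
  next
    fix x assume "x \<in> closed_segment 0 (cis ?L, 0 :: real)"
    then obtain \<rho> where \<rho>: "x = \<rho> *\<^sub>R (cis ?L, 0 :: real)" "0 \<le> \<rho>" "\<rho> \<le> 1"
      by (auto simp: closed_segment_def)
    then have "x = cone_pt n (?L, \<rho>)"
      using L by (simp add: cone_pt_def scaleR_conv_of_real del: of_nat_Suc)
    moreover have "(?L, \<rho>) \<in> ?R" using \<rho> L by simp
    moreover have "x \<in> ?D" using \<rho> by (simp add: norm_mult)
    ultimately show "x \<in> ?D \<inter> cone_pt n ` ?R" by blast
  qed
  then show "AR (?D \<inter> cone_pt n ` ?R)"
    by (simp only:) (intro convex_imp_AR convex_closed_segment, auto)
qed

section \<open>A ladder of maps without coincidences\<close>

text \<open>
  The new value of \<open>\<rho>\<close>. The term \<open>1 - 2\<rho>\<close> acts on the core \<open>\<rho> \<le> 1/2\<close> and moves the apex to the end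
  \<open>\<rho> = 1\<close> of an edge. The term \<open>3\<rho> - 3/2\<close> stretches the rest, \<open>\<rho> \<ge> 1/2\<close>, over the whole range; it
  crosses the diagonal at \<open>\<rho> = 3/4\<close> and stays above it until \<open>\<rho> = 1\<close>. The last term matters only
  for \<open>s < \<pi>\<close> and raises the points near the edge \<open>s = 0\<close>, where \<open>s\<close> cannot be decreased.
\<close>

definition radial :: "real \<Rightarrow> real \<Rightarrow> real" where
  "radial s \<rho> = max (max (1 - 2 * \<rho>) (min 1 (3 * \<rho> - 3 / 2))) (1 - s / pi)"

text \<open>
  The change of \<open>s\<close> outside the core. It is \<open>-\<pi>\<close> up to the value \<open>\<rho> = 3/4\<close>, at which \<open>\<rho>\<close> may be
  preserved, and must not be a multiple of \<open>2\<pi>\<close> at \<open>\<rho> = 1\<close>, at which \<open>\<rho>\<close> is preserved again. The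
  value \<open>\<pi>\<close> there is the same rotation of the loop as \<open>-\<pi>\<close>, but on the sheet it leads away from the
  edge \<open>s = 0\<close>. The shift vanishes in between, at \<open>\<rho> = 7/8\<close>, where \<open>\<rho>\<close> increases.
\<close>

definition shift :: "real \<Rightarrow> real" where
  "shift \<rho> = max (- pi) ((8 * \<rho> - 7) * pi)"

definition move :: "real \<times> real \<Rightarrow> real \<times> real" where
  "move = (\<lambda>(s, \<rho>). (if \<rho> \<le> 1/2 then 0 else max 0 (s + shift \<rho>), radial s \<rho>))"

lemma shift_bounds:
  assumes "\<rho> \<le> 1"
  shows "\<bar>shift \<rho>\<bar> \<le> pi"
proof -
  have "(8 * \<rho> - 7) * pi \<le> 1 * pi" using assms by (intro mult_right_mono) auto
  then show ?thesis unfolding shift_def using pi_gt_zero by linarith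
qed

lemma radial_bounds:
  assumes "0 \<le> s" "0 \<le> \<rho>" "\<rho> \<le> 1"
  shows "0 \<le> radial s \<rho>" "radial s \<rho> \<le> 1"
proof -
  have "0 \<le> s / pi" using assms by simp
  then show "radial s \<rho> \<le> 1"
    using assms by (auto simp: radial_def)
  show "0 \<le> radial s \<rho>"
    by (cases "\<rho> \<le> 1/2") (auto simp: radial_def le_max_iff_disj)
qed

lemma radial_far:
  assumes "s \<ge> pi"
  shows "radial s \<rho> = max (1 - 2 * \<rho>) (min 1 (3 * \<rho> - 3 / 2))"
proof -
  have "1 - s / pi \<le> 0" using assms by (simp add: le_divide_eq)
  also have "0 \<le> max (1 - 2 * \<rho>) (min 1 (3 * \<rho> - 3 / 2))"
    by (cases "\<rho> \<le> 1/2") (auto simp: le_max_iff_disj)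
  finally show ?thesis unfolding radial_def by (rule max_absorb1)
qed

lemma move_halfstrip: "x \<in> halfstrip \<Longrightarrow> move x \<in> halfstrip"
  by (auto simp: move_def halfstrip_def radial_bounds)

text \<open>
  The first coordinate of \<open>move (s, \<rho>)\<close> jumps at \<open>\<rho> = 1/2\<close>, but only for \<open>s > \<pi>\<close>. There the second
  coordinate is \<open>0\<close>, so the jump takes place inside the fibre of the apex.
\<close>

lemma continuous_on_move: "continuous_on halfstrip (\<lambda>x. cone_pt n (move x))"
proof -
  let ?A = "{0..} \<times> {0..1/2} :: (real \<times> real) set" and ?B = "{0..} \<times> {1/2..1} :: (real \<times> real) set"
  let ?f = "\<lambda>x :: real \<times> real. cone_pt n (0, radial (fst x) (snd x))"
  let ?g = "\<lambda>x :: real \<times> real. cone_pt n (max 0 (fst x + shift (snd x)), radial (fst x) (snd x))"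
  have "halfstrip = ?A \<union> ?B" by (auto simp: halfstrip_def)
  moreover have "continuous_on (?A \<union> ?B) (\<lambda>x. if snd x \<le> 1/2 then ?f x else ?g x)"
  proof (rule continuous_on_cases)
    show "closed ?A" "closed ?B" by (intro closed_Times; simp)+
    show "continuous_on ?A ?f" "continuous_on ?B ?g"
      unfolding radial_def shift_def by (auto intro!: continuous_intros)
    show "\<forall>x. x \<in> ?A \<and> \<not> snd x \<le> 1/2 \<or> x \<in> ?B \<and> snd x \<le> 1/2 \<longrightarrow> ?f x = ?g x"
    proof clarify
      fix s \<rho> :: real
      assume "(s, \<rho>) \<in> ?A \<and> \<not> snd (s, \<rho>) \<le> 1/2 \<or> (s, \<rho>) \<in> ?B \<and> snd (s, \<rho>) \<le> 1/2"
      then have [simp]: "\<rho> = 1/2" and "s \<ge> 0" by auto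
      have "radial s \<rho> = max 0 (1 - s / pi)" "shift \<rho> = - pi"
        by (auto simp: radial_def shift_def)
      then show "?f (s, \<rho>) = ?g (s, \<rho>)" by (cases "s \<le> pi") (auto simp: max_def)
    qed
  qed
  ultimately have "continuous_on halfstrip (\<lambda>x. if snd x \<le> 1/2 then ?f x else ?g x)"
    by simp
  then show ?thesis
    by (rule continuous_on_eq) (simp add: move_def case_prod_unfold)
qed

text \<open>
  A point on the loop of \<open>\<Gamma>\<^sub>n\<^sub>+\<^sub>1\<close> has \<open>s \<ge> L\<^sub>n\<^sub>+\<^sub>1 = L\<^sub>n + \<pi>\<close>. After a shift by at most \<open>\<pi>\<close> it is still on
  the loop of \<open>\<Gamma>\<^sub>n\<close>, so the identification modulo \<open>2\<pi>\<close> survives. Moreover \<open>s \<ge> \<pi>\<close> implies that the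
  new value of \<open>\<rho>\<close> does not depend on \<open>s\<close>.
\<close>

lemma cone_pt_move_fibre:
  assumes "x \<in> halfstrip" "y \<in> halfstrip" "cone_pt (Suc n) x = cone_pt (Suc n) y"
  shows "cone_pt n (move x) = cone_pt n (move y)"
proof -
  obtain s \<rho> t \<tau> where xy: "x = (s, \<rho>)" "y = (t, \<tau>)" by fastforce
  have b: "0 \<le> s" "0 \<le> t" "0 \<le> \<rho>" "\<rho> \<le> 1" "0 \<le> \<tau>" using assms xy by (auto simp: halfstrip_def)
  let ?L = "real (Suc n) * pi"
  have L: "?L > 0" by simp
  from cone_pt_eqD[OF assms(3)[unfolded xy] b(3,5)]
  have [simp]: "\<tau> = \<rho>"
    and "\<rho> = 0 \<or> s = t \<or> (s \<ge> ?L + pi \<and> t \<ge> ?L + pi \<and> cis s = cis t)"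
    by (auto simp: algebra_simps)
  then consider "\<rho> = 0" | "s = t" | "s \<ge> ?L + pi" "t \<ge> ?L + pi" "cis s = cis t" by blast
  then show ?thesis
  proof cases
    case 1
    with b show ?thesis by (auto simp: xy move_def radial_def)
  next
    case 2
    then show ?thesis by (simp add: xy)
  next
    case 3
    then have "s \<ge> pi" "t \<ge> pi" using L by linarith+
    then have h: "radial s \<rho> = radial t \<rho>" by (simp add: radial_far)
    have "s + shift \<rho> \<ge> ?L" "t + shift \<rho> \<ge> ?L" using 3 shift_bounds[of \<rho>] b by linarith+
    moreover have "cis (s + shift \<rho>) = cis (t + shift \<rho>)" using 3 by (simp flip: cis_mult)
    ultimately have "cone_pt n (s + shift \<rho>, radial t \<rho>) = cone_pt n (t + shift \<rho>, radial t \<rho>)"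
      by (intro cone_pt_wrapped_eq)
    moreover have "max 0 (s + shift \<rho>) = s + shift \<rho>" "max 0 (t + shift \<rho>) = t + shift \<rho>"
      using \<open>s + shift \<rho> \<ge> ?L\<close> \<open>t + shift \<rho> \<ge> ?L\<close> L by linarith+
    ultimately show ?thesis using h by (simp add: xy move_def)
  qed
qed

text \<open>Passing from level \<open>n + 1\<close> to level \<open>n\<close> wraps another half-turn of the arc onto the loop.\<close>

lemma cone_pt_pred_fibre:
  assumes "x \<in> halfstrip" "y \<in> halfstrip" "cone_pt (Suc n) x = cone_pt (Suc n) y"
  shows "cone_pt n x = cone_pt n y"
proof -
  obtain s \<rho> t \<tau> where xy: "x = (s, \<rho>)" "y = (t, \<tau>)" by fastforce
  have b: "0 \<le> \<rho>" "0 \<le> \<tau>" using assms xy by (auto simp: halfstrip_def)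
  from cone_pt_eqD[OF assms(3)[unfolded xy] b]
  have [simp]: "\<tau> = \<rho>"
    and "\<rho> = 0 \<or> s = t \<or> (s \<ge> real (Suc n) * pi + pi \<and> t \<ge> real (Suc n) * pi + pi \<and> cis s = cis t)"
    by (auto simp: algebra_simps)
  then consider "\<rho> = 0" | "s = t"
    | "s \<ge> real (Suc n) * pi + pi" "t \<ge> real (Suc n) * pi + pi" "cis s = cis t" by blast
  then show ?thesis
  proof cases
    case 3
    then have "s \<ge> real (Suc n) * pi" "t \<ge> real (Suc n) * pi" using pi_gt_zero by linarith+
    then have "cone_pt n (s, \<rho>) = cone_pt n (t, \<rho>)" using 3(3) by (rule cone_pt_wrapped_eq)
    then show ?thesis by (simp add: xy)
  qed (simp_all add: xy)
qed

text \<open>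
  In a coincidence \<open>\<rho>\<close> is preserved and not \<open>0\<close>, because the apex is moved. In the core the image lies
  on the edge \<open>s = 0\<close>, where every point is moved to \<open>\<rho> = 1\<close>, out of the core. Outside the core the shift would have
  to be a multiple of \<open>2\<pi>\<close> and hence \<open>0\<close>, which happens only at \<open>\<rho> = 7/8\<close>, where \<open>\<rho>\<close> increases.
\<close>

lemma move_no_fixed_point:
  assumes "x \<in> halfstrip"
  shows "cone_pt 0 (move x) \<noteq> cone_pt 0 x"
proof
  assume eq: "cone_pt 0 (move x) = cone_pt 0 x"
  obtain s \<rho> where x: "x = (s, \<rho>)" by fastforce
  have b: "0 \<le> s" "0 \<le> \<rho>" "\<rho> \<le> 1" using assms x by (auto simp: halfstrip_def)
  define \<sigma> where "\<sigma> = fst (move x)"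
  have mv: "move x = (\<sigma>, radial s \<rho>)" by (simp add: \<sigma>_def move_def x)
  have h0: "radial s \<rho> \<ge> 0"
    using move_halfstrip[OF assms] mv by (simp add: halfstrip_def)
  have "cone_pt 0 (\<sigma>, radial s \<rho>) = cone_pt 0 (s, \<rho>)" using eq[unfolded mv] unfolding x .
  from cone_pt_eqD[OF this h0 b(2)]
  have h: "radial s \<rho> = \<rho>" and "\<rho> = 0 \<or> \<sigma> = s \<or> (\<sigma> \<ge> pi \<and> s \<ge> pi \<and> cis \<sigma> = cis s)"
    by auto
  moreover have "0 < u" if "pi \<le> u" for u using that pi_gt_zero by linarith
  ultimately have cases: "\<rho> = 0 \<or> \<sigma> = s \<or> (\<sigma> > 0 \<and> s > 0 \<and> cis \<sigma> = cis s)"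
    by blast
  have "\<rho> \<noteq> 0" using h by (auto simp: radial_def)
  have "\<rho> \<noteq> 7/8" using h by (auto simp: radial_def max_def split: if_splits)
  show False
  proof (cases "\<rho> \<le> 1/2")
    case True
    then have "\<sigma> = 0" by (simp add: \<sigma>_def move_def x)
    with cases \<open>\<rho> \<noteq> 0\<close> have "s = 0" by auto
    with h True show False by (auto simp: radial_def)
  next
    case False
    then have \<sigma>: "\<sigma> = max 0 (s + shift \<rho>)" by (simp add: \<sigma>_def move_def x)
    have "\<sigma> = s + shift \<rho> \<and> cis \<sigma> = cis s"
    proof (cases "s = 0")
      case True
      then have "\<rho> = 1" using h b by (auto simp: radial_def)
      with True \<sigma> cases have False by (auto simp: shift_def)
      then show ?thesis ..
    next
      case False
      with cases \<open>\<rho> \<noteq> 0\<close> \<sigma> b show ?thesis by (auto simp: max_def split: if_splits)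
    qed
    then have "cis (s + shift \<rho>) = cis s" by metis
    then have "cis s * cis (shift \<rho>) = cis s" by (simp add: cis_mult)
    then have "cis (shift \<rho>) = 1" by simp
    then have "cos (shift \<rho>) = 1" by (metis cis.sel(1) one_complex.sel(1))
    then obtain k :: int where k: "shift \<rho> = of_int k * 2 * pi" using cos_one_2pi_int by blast
    have "shift \<rho> = 0"
    proof -
      have "\<bar>of_int k * 2\<bar> * pi \<le> 1 * pi" using shift_bounds[OF b(3)] k by (simp add: abs_mult)
      then have "\<bar>of_int k * 2 :: real\<bar> \<le> 1" by (rule mult_right_le_imp_le) simp
      then have "k = 0" by linarith
      with k show ?thesis by simp
    qed
    then show False using \<open>\<rho> \<noteq> 7/8\<close> by (auto simp: shift_def max_def split: if_splits)
  qed
qed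

lemma bonding_maps:
  obtains f g :: "nat \<Rightarrow> complex \<times> real \<Rightarrow> complex \<times> real"
  where "\<And>n. continuous_on (wound_cone (Suc n)) (f n)" "\<And>n. continuous_on (wound_cone (Suc n)) (g n)"
    and "\<And>n. f n ` wound_cone (Suc n) \<subseteq> wound_cone n" "\<And>n. g n ` wound_cone (Suc n) \<subseteq> wound_cone n"
    and "\<And>n z. z \<in> wound_cone (Suc (Suc n)) \<Longrightarrow> f n (g (Suc n) z) = g n (f (Suc n) z)"
    and "\<And>z. z \<in> wound_cone (Suc 0) \<Longrightarrow> f 0 z \<noteq> g 0 z"
proof -
  have "\<exists>f. continuous_on (wound_cone (Suc n)) f \<and>
      (\<forall>x\<in>halfstrip. f (cone_pt (Suc n) x) = cone_pt n (move x))" for n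
  proof -
    obtain f where "continuous_on (cone_pt (Suc n) ` halfstrip) f"
      "\<And>x. x \<in> halfstrip \<Longrightarrow> f (cone_pt (Suc n) x) = cone_pt n (move x)"
      by (rule continuous_on_descend[where p = "cone_pt (Suc n)" and h = "\<lambda>x. cone_pt n (move x)",
            OF compact_rectangle rectangle_subset cone_pt_rectangle continuous_on_cone_pt'
              continuous_on_subset[OF continuous_on_move rectangle_subset]])
        (erule (2) cone_pt_move_fibre, rule that)
    then show ?thesis unfolding wound_cone_def by blast
  qed
  then obtain f where f: "\<And>n. continuous_on (wound_cone (Suc n)) (f n)"
    "\<And>n x. x \<in> halfstrip \<Longrightarrow> f n (cone_pt (Suc n) x) = cone_pt n (move x)" by metis
  have "\<exists>g. continuous_on (wound_cone (Suc n)) g \<and>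
      (\<forall>x\<in>halfstrip. g (cone_pt (Suc n) x) = cone_pt n x)" for n
  proof -
    obtain g where "continuous_on (cone_pt (Suc n) ` halfstrip) g"
      "\<And>x. x \<in> halfstrip \<Longrightarrow> g (cone_pt (Suc n) x) = cone_pt n x"
      by (rule continuous_on_descend[where p = "cone_pt (Suc n)" and h = "cone_pt n",
            OF compact_rectangle rectangle_subset cone_pt_rectangle continuous_on_cone_pt'
              continuous_on_cone_pt'])
        (erule (2) cone_pt_pred_fibre, rule that)
    then show ?thesis unfolding wound_cone_def by blast
  qed
  then obtain g where g: "\<And>n. continuous_on (wound_cone (Suc n)) (g n)"
    "\<And>n x. x \<in> halfstrip \<Longrightarrow> g n (cone_pt (Suc n) x) = cone_pt n x" by metis
  show thesis
  proof (rule that[OF f(1) g(1)])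
    show "f n ` wound_cone (Suc n) \<subseteq> wound_cone n" "g n ` wound_cone (Suc n) \<subseteq> wound_cone n" for n
      by (auto simp: wound_cone_def f g move_halfstrip)
    show "f n (g (Suc n) z) = g n (f (Suc n) z)" if "z \<in> wound_cone (Suc (Suc n))" for n z
      using that by (auto simp: wound_cone_def f g move_halfstrip)
    show "f 0 z \<noteq> g 0 z" if "z \<in> wound_cone (Suc 0)" for z
      using that by (auto simp: wound_cone_def f g move_no_fixed_point)
  qed
qed

section \<open>Cubes of square-summable sequences\<close>

text \<open>
  A Hilbert cube with a ball in every coordinate. On it the norm topology is that of coordinatewise
  convergence: the radii form a square-summable sequence, so the tails of the norm are uniformly small.
\<close>

definition dyadic_cube :: "'a::real_inner ell2 set" where
  "dyadic_cube = {x. \<forall>n. norm (coord x n) \<le> (1/2) ^ n}"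

definition dyadic_seq :: "(nat \<Rightarrow> 'a::real_inner) \<Rightarrow> 'a ell2" where
  "dyadic_seq y = Abs_ell2 (\<lambda>n. (1/2) ^ n *\<^sub>R y n)"

lemma half_power_sq: "((1/2 :: real) ^ n)\<^sup>2 = (1/4) ^ n"
  unfolding power2_eq_square power_mult_distrib[symmetric] by simp

lemma coord_dyadic_seq:
  assumes "\<And>n. norm (y n) \<le> 1"
  shows "coord (dyadic_seq y) n = (1/2) ^ n *\<^sub>R y n"
proof -
  have "square_summable (\<lambda>n. (1/2) ^ n *\<^sub>R y n)"
    unfolding square_summable_def
  proof (rule summable_comparison_test')
    show "summable (\<lambda>n. (1/4 :: real) ^ n)" by (rule summable_geometric) simp
    fix n :: nat
    have "(norm ((1/2) ^ n *\<^sub>R y n))\<^sup>2 = (1/4) ^ n * (norm (y n))\<^sup>2"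
      unfolding norm_scaleR power_mult_distrib half_power_sq[symmetric] by simp
    also have "\<dots> \<le> (1/4) ^ n * 1"
      using assms[of n] by (intro mult_left_mono power_le_one) auto
    finally show "norm ((norm ((1/2) ^ n *\<^sub>R y n))\<^sup>2) \<le> (1/4) ^ n" by simp
  qed
  then show ?thesis by (simp add: dyadic_seq_def Abs_ell2_inverse)
qed

lemma scaled_coord_dyadic_seq:
  "(\<And>n. norm (y n) \<le> 1) \<Longrightarrow> 2 ^ n *\<^sub>R coord (dyadic_seq y) n = y n"
  by (simp add: coord_dyadic_seq power_one_over)

lemma dyadic_seq_in_cube: "(\<And>n. norm (y n) \<le> 1) \<Longrightarrow> dyadic_seq y \<in> dyadic_cube"
  by (simp add: dyadic_cube_def coord_dyadic_seq mult_left_le)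

lemma dyadic_seq_coord: "dyadic_seq (\<lambda>n. 2 ^ n *\<^sub>R coord x n) = x"
  by (simp add: dyadic_seq_def coord_inverse power_one_over)

lemma norm_scaled_coord_le: "x \<in> dyadic_cube \<Longrightarrow> norm (2 ^ n *\<^sub>R coord x n) \<le> 1"
  by (simp add: dyadic_cube_def power_one_over field_simps)

lemma convex_dyadic_cube: "convex (dyadic_cube :: 'a::real_inner ell2 set)"
proof -
  have eq: "dyadic_cube = (\<Inter>n. {x. coord x n \<in> cball 0 ((1/2) ^ n)})"
    by (auto simp: dyadic_cube_def)
  have "convex {x :: 'a ell2. coord x n \<in> cball 0 ((1/2) ^ n)}" for n
    proof (rule convexI)
    fix x y :: "'a ell2" and u v :: real
    assume "x \<in> {x. coord x n \<in> cball 0 ((1/2) ^ n)}" "y \<in> {x. coord x n \<in> cball 0 ((1/2) ^ n)}"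
      and "0 \<le> u" "0 \<le> v" "u + v = 1"
    then have "u *\<^sub>R coord x n + v *\<^sub>R coord y n \<in> cball 0 ((1/2) ^ n)"
      by (intro convexD[OF convex_cball]) simp_all
    then show "u *\<^sub>R x + v *\<^sub>R y \<in> {x. coord x n \<in> cball 0 ((1/2) ^ n)}" by simp
  qed
  then show ?thesis unfolding eq by (rule convex_INT)
qed

lemma continuous_on_coord: "continuous_on S (\<lambda>x. coord x n)"
proof -
  have "bounded_linear (\<lambda>x. coord x n)"
    by (rule bounded_linear_intro[where K = 1]) (auto simp: norm_coord_le)
  then show ?thesis by (rule linear_continuous_on)
qed

lemma continuous_on_into_dyadic_cube:
  fixes f :: "'a::topological_space \<Rightarrow> 'b::real_inner ell2"
  assumes f: "\<And>x. x \<in> S \<Longrightarrow> f x \<in> dyadic_cube"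
    and coord: "\<And>n. continuous_on S (\<lambda>x. coord (f x) n)"
  shows "continuous_on S f"
  unfolding continuous_on_def
proof
  fix a assume a: "a \<in> S"
  let ?d = "\<lambda>x n. (norm (coord (f x - f a) n))\<^sup>2"
  have "continuous_on S (\<lambda>x. \<Sum>n. ?d x n)"
  proof (rule uniform_limit_theorem)
    show "\<forall>\<^sub>F N in sequentially. continuous_on S (\<lambda>x. \<Sum>n<N. ?d x n)"
      by (auto intro!: always_eventually continuous_intros coord)
    show "uniform_limit S (\<lambda>N x. \<Sum>n<N. ?d x n) (\<lambda>x. \<Sum>n. ?d x n) sequentially"
    proof (rule Weierstrass_m_test)
      show "summable (\<lambda>n. 4 * (1/4 :: real) ^ n)" by (intro summable_mult summable_geometric) simp
      fix n x assume x: "x \<in> S"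
      have "norm (coord (f x - f a) n) \<le> norm (coord (f x) n) + norm (coord (f a) n)"
        by (simp add: norm_triangle_ineq4)
      also have "\<dots> \<le> 2 * (1/2) ^ n"
        using f[OF x] f[OF a] by (simp add: dyadic_cube_def) (smt (verit))
      finally have "?d x n \<le> (2 * (1/2) ^ n)\<^sup>2" by (intro power_mono) auto
      also have "\<dots> = 4 * (1/4) ^ n"
        unfolding power_mult_distrib half_power_sq by simp
      finally show "norm (?d x n) \<le> 4 * (1/4) ^ n" by simp
    qed
  qed simp
  moreover have "(\<Sum>n. ?d x n) = (norm (f x - f a))\<^sup>2" for x
    using norm_ell2_sums sums_unique by metis
  ultimately have "continuous_on S (\<lambda>x. sqrt ((norm (f x - f a))\<^sup>2))"
    by (intro continuous_on_real_sqrt) simp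
  then have "continuous_on S (\<lambda>x. norm (f x - f a))" by simp
  then have "((\<lambda>x. norm (f x - f a)) \<longlongrightarrow> norm (f a - f a)) (at a within S)"
    using a unfolding continuous_on_def by (rule bspec)
  then have "((\<lambda>x. norm (f x - f a)) \<longlongrightarrow> 0) (at a within S)" by simp
  then show "(f \<longlongrightarrow> f a) (at a within S)"
    by (rule Lim_null[THEN iffD2, OF tendsto_norm_zero_cancel])
qed

lemma compact_dyadic_cube: "compact (dyadic_cube :: 'a::euclidean_space ell2 set)"
proof -
  let ?P = "PiE UNIV (\<lambda>_ :: nat. cball (0::'a) 1)"
  have P: "norm (y n) \<le> 1" if "y \<in> ?P" for y n
    using that by (auto simp: PiE_iff)
  have "compactin (product_topology (\<lambda>_ :: nat. euclidean) UNIV) ?P"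
    by (auto simp: compactin_PiE)
  then have "compact ?P" by (simp add: euclidean_product_topology)
  moreover have "continuous_on ?P dyadic_seq"
  proof (rule continuous_on_into_dyadic_cube)
    show "dyadic_seq y \<in> dyadic_cube" if "y \<in> ?P" for y
      by (rule dyadic_seq_in_cube) (rule P[OF that])
    have "continuous_on ?P (\<lambda>y. (1/2) ^ n *\<^sub>R y n)" for n
      by (intro continuous_intros continuous_on_subset[OF continuous_on_product_coordinates]) auto
    then show "continuous_on ?P (\<lambda>y. coord (dyadic_seq y) n)" for n
      by (rule continuous_on_eq) (rule coord_dyadic_seq[symmetric], rule P)
  qed
  ultimately have "compact (dyadic_seq ` ?P)" by (intro compact_continuous_image)
  moreover have "dyadic_seq ` ?P = dyadic_cube"
  proof (intro equalityI subsetI)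
    fix x :: "'a ell2" assume "x \<in> dyadic_cube"
    then have "(\<lambda>n. 2 ^ n *\<^sub>R coord x n) \<in> ?P" using norm_scaled_coord_le by (auto simp: PiE_iff)
    then show "x \<in> dyadic_seq ` ?P" by (rule image_eqI[where f = dyadic_seq, OF dyadic_seq_coord[of x, symmetric]])
  qed (auto intro!: dyadic_seq_in_cube P)
  ultimately show ?thesis by simp
qed

section \<open>Commuting maps without coincidences\<close>

text \<open>
  The ladder lives in \<open>\<complex> \<times> \<real>\<close>. A point of it is stored in two consecutive planes of the sequence
  space, the real coordinate on the first axis of the second plane.
\<close>

definition plane_of :: "complex \<Rightarrow> real^2" where
  "plane_of z = (\<chi> i. if i = 1 then Re z else Im z)"

definition complex_of :: "real^2 \<Rightarrow> complex" where
  "complex_of v = Complex (v $ 1) (v $ 2)"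

lemma complex_of_plane_of [simp]: "complex_of (plane_of z) = z"
  by (simp add: complex_of_def plane_of_def)

lemma norm_plane_of [simp]: "norm (plane_of z) = norm z"
  by (simp add: plane_of_def norm_vec_def L2_set_def sum_2 cmod_def)

lemma norm_complex_of [simp]: "norm (complex_of v) = norm v"
  by (simp add: complex_of_def norm_vec_def L2_set_def sum_2 cmod_def)

lemma continuous_on_plane_of: "continuous_on S f \<Longrightarrow> continuous_on S (\<lambda>x. plane_of (f x))"
  unfolding plane_of_def
proof (rule continuous_on_vec_lambda)
  fix i :: 2 assume "continuous_on S f"
  then show "continuous_on S (\<lambda>x. if i = 1 then Re (f x) else Im (f x))"
    by (cases "i = 1") (auto intro!: continuous_intros)
qed

lemma continuous_on_complex_of: "continuous_on S f \<Longrightarrow> continuous_on S (\<lambda>x. complex_of (f x))"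
  unfolding complex_of_def Complex_eq by (auto intro!: continuous_intros)

definition node :: "(real^2) ell2 \<Rightarrow> nat \<Rightarrow> complex \<times> real" where
  "node x n = (complex_of (2 ^ (2 * n) *\<^sub>R coord x (2 * n)),
               Re (complex_of (2 ^ (2 * n + 1) *\<^sub>R coord x (2 * n + 1))))"

definition from_nodes :: "(nat \<Rightarrow> complex \<times> real) \<Rightarrow> (real^2) ell2" where
  "from_nodes z = dyadic_seq (\<lambda>m. plane_of (if even m then fst (z (m div 2)) else of_real (snd (z (m div 2)))))"

text \<open>A convex body that contains all the cones.\<close>

abbreviation cylinder :: "(complex \<times> real) set" where
  "cylinder \<equiv> cball 0 1 \<times> {-1..1}"

lemma node_in_cylinder: "x \<in> dyadic_cube \<Longrightarrow> node x n \<in> cylinder"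
  using norm_scaled_coord_le[of x "2 * n"] norm_scaled_coord_le[of x "2 * n + 1"]
    abs_Re_le_cmod[of "complex_of (2 ^ (2 * n + 1) *\<^sub>R coord x (2 * n + 1))"]
  unfolding node_def norm_complex_of[symmetric] by (auto simp: abs_le_iff simp del: norm_complex_of norm_scaleR)

lemma continuous_on_node: "continuous_on S (\<lambda>x. node x n)"
  unfolding node_def by (intro continuous_intros continuous_on_complex_of continuous_on_coord)

lemma from_nodes_coord_le:
  assumes "\<And>n. z n \<in> cylinder"
  shows "norm (plane_of (if even m then fst (z (m div 2)) else of_real (snd (z (m div 2))))) \<le> 1"
  using assms[of "m div 2"] by (cases "z (m div 2)") auto

lemma from_nodes_in_cube: "(\<And>n. z n \<in> cylinder) \<Longrightarrow> from_nodes z \<in> dyadic_cube"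
  unfolding from_nodes_def by (intro dyadic_seq_in_cube from_nodes_coord_le)

lemma node_from_nodes:
  assumes "\<And>n. z n \<in> cylinder"
  shows "node (from_nodes z) n = z n"
proof -
  have eq: "2 ^ m *\<^sub>R coord (from_nodes z) m =
      plane_of (if even m then fst (z (m div 2)) else of_real (snd (z (m div 2))))" for m
    unfolding from_nodes_def by (rule scaled_coord_dyadic_seq) (rule from_nodes_coord_le[OF assms])
  show ?thesis unfolding node_def eq by simp
qed

lemma continuous_on_from_nodes:
  assumes cyl: "\<And>x n. x \<in> S \<Longrightarrow> z x n \<in> cylinder"
    and cont: "\<And>n. continuous_on S (\<lambda>x. z x n)"
  shows "continuous_on S (\<lambda>x. from_nodes (z x))"
proof (rule continuous_on_into_dyadic_cube)
  show "from_nodes (z x) \<in> dyadic_cube" if "x \<in> S" for x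
    using cyl[OF that] by (rule from_nodes_in_cube)
  fix m
  have "continuous_on S (\<lambda>x. (1/2) ^ m *\<^sub>R
      plane_of (if even m then fst (z x (m div 2)) else of_real (snd (z x (m div 2)))))"
    by (cases "even m") (auto intro!: continuous_intros continuous_on_plane_of cont)
  then show "continuous_on S (\<lambda>x. coord (from_nodes (z x)) m)"
    by (rule continuous_on_eq)
      (unfold from_nodes_def, rule coord_dyadic_seq[symmetric], rule from_nodes_coord_le, rule cyl)
qed

text \<open>
  The retraction \<open>r\<close> makes the map at each level defined on the whole convex body. As \<open>r\<close> is the
  identity on the values of \<open>f\<close> and \<open>g\<close>, it drops out of the compositions \<open>F \<circ> G\<close> and \<open>G \<circ> F\<close>
  except at the innermost place, where both have the same one.
\<close>

lemma commuting_maps_without_coincidence: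
  obtains F G :: "(real^2) ell2 \<Rightarrow> (real^2) ell2"
  where "continuous_on dyadic_cube F" "F \<in> dyadic_cube \<rightarrow> dyadic_cube"
    "continuous_on dyadic_cube G" "G \<in> dyadic_cube \<rightarrow> dyadic_cube"
    "\<And>x. x \<in> dyadic_cube \<Longrightarrow> F (G x) = G (F x)"
    "\<And>x. x \<in> dyadic_cube \<Longrightarrow> F x \<noteq> G x"
proof -
  obtain f g
    where fg_cont: "\<And>n. continuous_on (wound_cone (Suc n)) (f n)"
      "\<And>n. continuous_on (wound_cone (Suc n)) (g n)"
    and fg_cone: "\<And>n. f n ` wound_cone (Suc n) \<subseteq> wound_cone n" "\<And>n. g n ` wound_cone (Suc n) \<subseteq> wound_cone n"
    and comm: "\<And>n z. z \<in> wound_cone (Suc (Suc n)) \<Longrightarrow> f n (g (Suc n) z) = g n (f (Suc n) z)"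
    and diff: "\<And>z. z \<in> wound_cone (Suc 0) \<Longrightarrow> f 0 z \<noteq> g 0 z"
    by (rule bonding_maps) (rule that)
  have "wound_cone n retract_of cylinder" for n
    using AR_wound_cone compact_wound_cone wound_cone_subset
    by (intro AR_imp_retract conjI closed_subset compact_imp_closed)
  then have "\<exists>r. continuous_on cylinder r \<and> r ` cylinder \<subseteq> wound_cone n \<and> (\<forall>z\<in>wound_cone n. r z = z)" for n
    unfolding retract_of_def retraction_def by blast
  then obtain r where r: "\<And>n. continuous_on cylinder (r n)" "\<And>n. r n ` cylinder \<subseteq> wound_cone n"
    "\<And>n z. z \<in> wound_cone n \<Longrightarrow> r n z = z"
    by metis
  define lift where "lift h x = from_nodes (\<lambda>n. h n (r (Suc n) (node x (Suc n))))"
    for h :: "nat \<Rightarrow> complex \<times> real \<Rightarrow> complex \<times> real" and x :: "(real^2) ell2"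
  have r_node: "r n (node x n) \<in> wound_cone n" if "x \<in> dyadic_cube" for x n
    using r(2) node_in_cylinder[OF that] by blast
  have h_cone: "h n (r (Suc n) (node x (Suc n))) \<in> wound_cone n"
    if "\<And>n. h n ` wound_cone (Suc n) \<subseteq> wound_cone n" "x \<in> dyadic_cube" for h x n
    using that(1)[of n] r_node[OF that(2)] by blast
  have h_cyl: "h n (r (Suc n) (node x (Suc n))) \<in> cylinder"
    if "\<And>n. h n ` wound_cone (Suc n) \<subseteq> wound_cone n" "x \<in> dyadic_cube" for h x n
    using h_cone[OF that] wound_cone_subset by blast
  have node_lift: "node (lift h x) n = h n (r (Suc n) (node x (Suc n)))"
    if "\<And>n. h n ` wound_cone (Suc n) \<subseteq> wound_cone n" "x \<in> dyadic_cube" for h x n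
    unfolding lift_def by (rule node_from_nodes) (rule h_cyl[OF that])
  have lift_cube: "lift h \<in> dyadic_cube \<rightarrow> dyadic_cube" if "\<And>n. h n ` wound_cone (Suc n) \<subseteq> wound_cone n" for h
    unfolding lift_def by (intro funcsetI from_nodes_in_cube h_cyl that)
  have lift_cont: "continuous_on dyadic_cube (lift h)"
    if "\<And>n. h n ` wound_cone (Suc n) \<subseteq> wound_cone n" "\<And>n. continuous_on (wound_cone (Suc n)) (h n)" for h
    unfolding lift_def
  proof (rule continuous_on_from_nodes)
    show "h n (r (Suc n) (node x (Suc n))) \<in> cylinder" if "x \<in> dyadic_cube" for x n
      by (rule h_cyl) fact+
    fix n
    have "continuous_on dyadic_cube (\<lambda>x. r (Suc n) (node x (Suc n)))"
      by (rule continuous_on_compose2[OF r(1) continuous_on_node]) (use node_in_cylinder in blast)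
    then show "continuous_on dyadic_cube (\<lambda>x. h n (r (Suc n) (node x (Suc n))))"
      by (rule continuous_on_compose2[OF that(2)]) (use r_node in blast)
  qed
  have lift_lift: "lift h (lift k x) = from_nodes (\<lambda>n. h n (k (Suc n) (r (Suc (Suc n)) (node x (Suc (Suc n))))))"
    if "\<And>n. k n ` wound_cone (Suc n) \<subseteq> wound_cone n" "x \<in> dyadic_cube" for h k x
    unfolding lift_def[of h] by (simp add: node_lift[OF that] r(3)[OF h_cone[OF that]])
  show thesis
  proof (rule that[of "lift f" "lift g"])
    show "continuous_on dyadic_cube (lift f)" "continuous_on dyadic_cube (lift g)"
      by (intro lift_cont fg_cont fg_cone)+
    show "lift f \<in> dyadic_cube \<rightarrow> dyadic_cube" "lift g \<in> dyadic_cube \<rightarrow> dyadic_cube"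
      by (intro lift_cube fg_cone)+
    fix x :: "(real^2) ell2" assume x: "x \<in> dyadic_cube"
    show "lift f (lift g x) = lift g (lift f x)"
      by (simp add: lift_lift[OF fg_cone(1) x] lift_lift[OF fg_cone(2) x] comm[OF r_node[OF x]])
    have "node (lift f x) 0 \<noteq> node (lift g x) 0"
      using diff r_node[OF x] by (simp add: node_lift[OF fg_cone(1) x] node_lift[OF fg_cone(2) x])
    then show "lift f x \<noteq> lift g x" by metis
  qed
qed

text \<open>
  The case of Horn's conjecture in which the Banach space is a whole type with its own norm.
\<close>

lemma Horn_conjectureD:
  fixes K :: "'a::banach set"
  assumes "Horn_conjecture TYPE('a)" "K \<noteq> {}" "compact K" "convex K"
    and "continuous_on K F" "F \<in> K \<rightarrow> K" "continuous_on K G" "G \<in> K \<rightarrow> K"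
    and "\<And>x. x \<in> K \<Longrightarrow> F (G x) = G (F x)"
  shows "\<exists>x\<in>K. F x = G x"
proof -
  have "continuous_map (top_of_set K) (top_of_set K) F" "continuous_map (top_of_set K) (top_of_set K) G"
    using assms by (auto simp: continuous_map_in_subtopology)
  moreover have "compactin euclidean K" using assms by simp
  ultimately show ?thesis
    using assms(1)[unfolded Horn_conjecture_def, rule_format, OF banach_space_on_UNIV,
        unfolded norm_topology_UNIV, of K F G] assms by blast
qed

theorem theorem1:
  shows "(\<exists>(K :: (real^2) ell2 set) (F :: (real^2) ell2 \<Rightarrow> (real^2) ell2) (G :: (real^2) ell2 \<Rightarrow> (real^2) ell2).
            K \<noteq> {} \<and> compact K \<and> convex K \<and>
            continuous_on K F \<and> F \<in> K \<rightarrow> K \<and>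
            continuous_on K G \<and> G \<in> K \<rightarrow> K \<and>
            (\<forall>x\<in>K. F (G x) = G (F x)) \<and>
            (\<forall>x\<in>K. F x \<noteq> G x))
         \<and> \<not> Horn_conjecture TYPE((real^2) ell2)"
proof -
  obtain F G :: "(real^2) ell2 \<Rightarrow> (real^2) ell2"
    where F: "continuous_on dyadic_cube F" "F \<in> dyadic_cube \<rightarrow> dyadic_cube"
    and G: "continuous_on dyadic_cube G" "G \<in> dyadic_cube \<rightarrow> dyadic_cube"
    and FG: "\<And>x. x \<in> dyadic_cube \<Longrightarrow> F (G x) = G (F x)"
    and neq: "\<And>x. x \<in> dyadic_cube \<Longrightarrow> F x \<noteq> G x"
    using commuting_maps_without_coincidence by blast
  let ?K = "dyadic_cube :: (real^2) ell2 set"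
  have ne: "?K \<noteq> {}" using dyadic_seq_in_cube[of "\<lambda>_. 0"] by auto
  have "\<not> Horn_conjecture TYPE((real^2) ell2)"
  proof
    assume "Horn_conjecture TYPE((real^2) ell2)"
    then have "\<exists>x\<in>?K. F x = G x"
      using ne compact_dyadic_cube convex_dyadic_cube F G FG by (rule Horn_conjectureD)
    with neq show False by blast
  qed
  with F G FG neq ne compact_dyadic_cube convex_dyadic_cube show ?thesis by blast
qed

end
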